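(* Let $n\ge1$ be an integer and $q$ a prime power. There exists a rank-$1$ Kakeya set $K\subseteq\mathbb{F}_q^n$ with $$|K|<\begin{cases}2\big(1+\frac1{q-1}\big)\left(\frac{q+1}2\right)^n & \text{if $q$ is odd},\\[2pt] \frac32\big(1+\frac1{q-1}\big)\left(\frac{2q+1}3\right)^n & \text{if $q$ is an even power of $2$},\\[2pt] \frac32\left(\frac{2(q+\sqrt q+1)}3\right)^n & \text{if $q$ is an odd power of $2$}.\end{cases}$$
   Context: $\mathbb{F}_q$ denotes the finite field with $q$ elements. A subset $K\subseteq\mathbb{F}_q^n$ is a rank-$1$ Kakeya set if for every one-dimensional subspace $L\le\mathbb{F}_q^n$ there exists $v\in\mathbb{F}_q^n$ with $v+L\subseteq K$ (i.e., $K$ contains a full line in every direction). *)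

theory Defs
  imports "HOL-Analysis.Cartesian_Space" "HOL-Number_Theory.Prime_Powers"
begin

definition rank1_kakeya_set :: "('a::field ^ 'n) set \<Rightarrow> bool" where
  "rank1_kakeya_set K \<longleftrightarrow>
     (\<forall>L. vec.subspace L \<and> vec.dim L = 1 \<longrightarrow> (\<exists>v. (+) v ` L \<subseteq> K))"

end

theory Submission
  imports Defs
begin

text \<open>
  With \<open>I(t) = {x\<^sup>2 + t x}\<close>, the line through \<open>(0, d\<^sub>2\<^sup>2, \<dots>, d\<^sub>n\<^sup>2)\<close> in direction
  \<open>(1, d\<^sub>2, \<dots>, d\<^sub>n)\<close> stays in \<open>{v. v\<^sub>i \<in> I(v\<^sub>1) for i > 1}\<close>. Replacing \<open>v\<^sub>1\<close> by \<open>v\<^sub>1 - c\<^sub>i\<close> in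
  the \<open>i\<close>-th condition and choosing the shifts \<open>c\<^sub>i\<close> by averaging, only the mean of \<open>card (I t)\<close> over
  all \<open>t\<close> matters. Since \<open>x\<^sup>2 + t x = - x y\<close> for \<open>y = - t - x\<close>, the pairs \<open>(t, z)\<close> with
  \<open>z \<in> I(t)\<close> correspond to unordered pairs \<open>{x, y}\<close>, so the mean is \<open>(q + 1) / 2\<close> in every
  characteristic. Summing over the position of the leading coordinate of the direction gives a
  Kakeya set of size at most \<open>q (1 + u + \<dots> + u\<^bsup>n-1\<^esup>)\<close> with \<open>u = (q + 1) / 2\<close>, which is
  below all three bounds.
\<close>

text \<open>By symmetry, each new element \<open>a\<close> contributes only the values
  \<open>g (a, x)\<close>, at most \<open>card A + 1\<close> of them; these increments add up to the
  number of unordered pairs with repetition.\<close>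

lemma card_symmetric_image_le:
  assumes "finite A" and sym: "\<And>x y. g (x, y) = g (y, x)"
  shows "2 * card (g ` (A \<times> A)) \<le> card A * (card A + 1)"
  using assms(1)
proof (induction A)
  case empty
  then show ?case by simp
next
  case (insert a A)
  have "g ` (insert a A \<times> insert a A) \<subseteq> g ` (A \<times> A) \<union> (\<lambda>x. g (a, x)) ` insert a A"
    using sym by auto
  then have "card (g ` (insert a A \<times> insert a A)) \<le>
      card (g ` (A \<times> A) \<union> (\<lambda>x. g (a, x)) ` insert a A)"
    using insert.hyps by (intro card_mono) auto
  also have "\<dots> \<le> card (g ` (A \<times> A)) + card ((\<lambda>x. g (a, x)) ` insert a A)"
    by (rule card_Un_le)
  also have "card ((\<lambda>x. g (a, x)) ` insert a A) \<le> card A + 1"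
    using card_image_le[of "insert a A" "\<lambda>x. g (a, x)"] insert.hyps by simp
  finally show ?case
    using insert by (simp add: algebra_simps)
qed

definition quad_range :: "'a::field \<Rightarrow> 'a set" where
  "quad_range t = range (\<lambda>x. x\<^sup>2 + t * x)"

text \<open>\<open>z \<in> quad_range t\<close> means that \<open>X^2 + t X - z\<close> has a root
  in the field, hence splits as \<open>(X - x) (X - y)\<close>. The map \<open>g\<close> recovers
  \<open>(t, z)\<close> from the roots and is symmetric in them.\<close>

lemma sum_card_quad_range:
  "2 * (\<Sum>t\<in>UNIV. card (quad_range (t :: 'a::{field,finite}))) \<le> CARD('a) * (CARD('a) + 1)"
proof -
  define g :: "'a \<times> 'a \<Rightarrow> 'a \<times> 'a" where "g = (\<lambda>(x, y). (- (x + y), - (x * y)))"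
  have "(t, z) \<in> range g" if "z \<in> quad_range t" for t z
  proof -
    from that obtain x where "z = x\<^sup>2 + t * x" by (auto simp: quad_range_def)
    then have "(t, z) = g (x, - t - x)"
      by (simp add: g_def power2_eq_square algebra_simps)
    then show ?thesis by blast
  qed
  then have "Sigma UNIV quad_range \<subseteq> range g" by auto
  then have "card (Sigma UNIV (quad_range :: 'a \<Rightarrow> _)) \<le> card (range g)"
    by (intro card_mono) auto
  moreover have "2 * card (g ` (UNIV \<times> UNIV)) \<le> CARD('a) * (CARD('a) + 1)"
    by (rule card_symmetric_image_le) (auto simp: g_def add.commute mult.commute)
  ultimately show ?thesis by simp
qed

text \<open>The shifts are chosen one at a time. Summed over all candidates \<open>b\<close> for the
  new shift, the factor \<open>h (t - b)\<close> gives the same total for every \<open>t\<close>, so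
  the double sum factors.\<close>

lemma ex_shifts_sum_prod_le:
  fixes h :: "'a::{ab_group_add,finite} \<Rightarrow> real" and A :: "'i set" and u :: real
  assumes "finite A" and nonneg: "\<And>t. h t \<ge> 0" and mean: "(\<Sum>t\<in>UNIV. h t) \<le> CARD('a) * u"
  shows "\<exists>c. (\<Sum>t\<in>UNIV. \<Prod>i\<in>A. h (t - c i)) \<le> CARD('a) * u ^ card A"
  using assms(1)
proof (induction A)
  case empty
  then show ?case by simp
next
  case (insert j A)
  then obtain c where c: "(\<Sum>t\<in>UNIV. \<Prod>i\<in>A. h (t - c i)) \<le> CARD('a) * u ^ card A"
    by blast
  define w where "w t = (\<Prod>i\<in>A. h (t - c i))" for t
  have w_nonneg: "w t \<ge> 0" for t
    unfolding w_def by (intro prod_nonneg) (auto simp: nonneg)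
  have u: "u \<ge> 0"
  proof -
    have "0 \<le> CARD('a) * u" using sum_nonneg[of UNIV h] nonneg mean by fastforce
    then show ?thesis by (simp add: zero_le_mult_iff)
  qed
  have shift: "(\<Sum>b\<in>UNIV. h (t - b)) = (\<Sum>b\<in>UNIV. h b)" for t
    by (rule sum.reindex_bij_witness[of _ "\<lambda>b. t - b" "\<lambda>b. t - b"]) auto
  have "(\<Sum>b\<in>UNIV. \<Sum>t\<in>UNIV. w t * h (t - b)) = (\<Sum>t\<in>UNIV. w t * (\<Sum>b\<in>UNIV. h (t - b)))"
    by (subst sum.swap) (simp add: sum_distrib_left)
  also have "\<dots> = (\<Sum>t\<in>UNIV. w t) * (\<Sum>b\<in>UNIV. h b)"
    by (simp add: shift sum_distrib_right)
  also have "\<dots> \<le> (CARD('a) * u ^ card A) * (CARD('a) * u)"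
    using c mean u by (intro mult_mono) (auto simp: w_def[symmetric] intro!: sum_nonneg nonneg)
  also have "\<dots> = (\<Sum>b\<in>(UNIV :: 'a set). CARD('a) * u ^ Suc (card A))"
    by simp
  finally have le: "(\<Sum>b\<in>UNIV. \<Sum>t\<in>UNIV. w t * h (t - b))
      \<le> (\<Sum>b\<in>(UNIV :: 'a set). CARD('a) * u ^ Suc (card A))" .
  \<comment> \<open>Some \<open>b\<close> does no worse than the average over all
    \<open>b\<close>.\<close>
  obtain b where b: "(\<Sum>t\<in>UNIV. w t * h (t - b)) \<le> CARD('a) * u ^ Suc (card A)"
  proof (rule ccontr)
    assume "\<not> thesis"
    then have "CARD('a) * u ^ Suc (card A) < (\<Sum>t\<in>UNIV. w t * h (t - b))" for b
      using that not_le by blast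
    then have "(\<Sum>b\<in>(UNIV :: 'a set). CARD('a) * u ^ Suc (card A))
        < (\<Sum>b\<in>UNIV. \<Sum>t\<in>UNIV. w t * h (t - b))"
      by (intro sum_strict_mono) auto
    with le show False by linarith
  qed
  have "(\<Prod>i\<in>insert j A. h (t - (c(j := b)) i)) = w t * h (t - b)" for t
  proof -
    have "(\<Prod>i\<in>A. h (t - (c(j := b)) i)) = w t"
      unfolding w_def using insert.hyps by (intro prod.cong) auto
    then show ?thesis using insert.hyps by (simp add: mult.commute)
  qed
  then have "(\<Sum>t\<in>UNIV. \<Prod>i\<in>insert j A. h (t - (c(j := b)) i)) \<le> CARD('a) * u ^ card (insert j A)"
    using b insert.hyps by (simp only: card_insert_disjoint not_False_eq_True)
  then show ?case by blast
qed

text \<open>This piece serves the directions whose last nonzero coordinate, in the order given by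
  the numbering \<open>e\<close>, is \<open>k\<close>. Coordinate \<open>k\<close> plays the role of
  \<open>v\<^sub>1\<close> in the overview.\<close>

definition layer :: "('n \<Rightarrow> nat) \<Rightarrow> 'n \<Rightarrow> ('n \<Rightarrow> 'a) \<Rightarrow> ('a::field ^ 'n) set" where
  "layer e k c = {v. (\<forall>i. e i < e k \<longrightarrow> v $ i \<in> quad_range (v $ k - c i)) \<and>
                     (\<forall>i. e i > e k \<longrightarrow> v $ i = 0)}"

lemma card_layer_le:
  fixes c :: "'n::finite \<Rightarrow> 'a::{field,finite}"
  assumes "inj e"
  shows "card (layer e k c) \<le> (\<Sum>t\<in>UNIV. \<Prod>i | e i < e k. card (quad_range (t - c i)))"
proof -
  define A where "A = {i. e i < e k}"
  define T where "T = (SIGMA t:UNIV. PiE A (\<lambda>i. quad_range (t - c i)))"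
  \<comment> \<open>The pivot value and the coordinates before it determine a point of the layer, as
    the later ones vanish.\<close>
  define p where "p v = (v $ k, restrict (($) v) A)" for v :: "'a ^ 'n"
  have "inj_on p (layer e k c)"
  proof (intro inj_onI)
    fix v w assume v: "v \<in> layer e k c" and w: "w \<in> layer e k c" and eq: "p v = p w"
    have "v $ i = w $ i" for i
    proof (cases "e i" "e k" rule: linorder_cases)
      case less
      then show ?thesis using eq by (auto simp: p_def A_def dest: fun_cong[of _ _ i])
    next
      case equal
      then have "i = k" using assms by (simp add: inj_eq)
      then show ?thesis using eq by (simp add: p_def)
    next
      case greater
      then show ?thesis using v w by (simp add: layer_def)
    qed
    then show "v = w" by (simp add: vec_eq_iff)
  qed
  moreover have "p ` layer e k c \<subseteq> T"
    unfolding p_def T_def by (auto simp: A_def layer_def simp del: restrict_apply intro!: restrict_PiE_iff[THEN iffD2])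
  moreover have "finite T"
    unfolding T_def by (intro finite_SigmaI finite_PiE) auto
  ultimately have "card (layer e k c) \<le> card T"
    by (rule card_inj_on_le)
  also have "card T = (\<Sum>t\<in>UNIV. card (PiE A (\<lambda>i. quad_range (t - c i))))"
    unfolding T_def by (rule card_SigmaI) (auto intro!: finite_PiE)
  finally show ?thesis by (simp add: card_PiE A_def)
qed

lemma line_subset_layer:
  fixes d :: "'a::field ^ 'n"
  assumes "inj e" and dk: "d $ k \<noteq> 0" and d0: "\<And>i. e i > e k \<Longrightarrow> d $ i = 0"
  shows "\<exists>v. \<forall>a. v + a *s d \<in> layer e k c"
proof -
  define x where "x i = d $ i / d $ k" for i
  \<comment> \<open>\<open>x\<close> is \<open>d\<close> scaled to have pivot entry 1. As
    \<open>v\<close> is 0 at \<open>k\<close>, the pivot value on the line is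
    \<open>s = a * d $ k\<close>, and coordinate \<open>i\<close> before the pivot is
    \<open>(x i)^2 - c i * x i + s * x i\<close>, the value at \<open>x i\<close> of the quadratic
    with parameter \<open>s - c i\<close>.\<close>
  define v where "v = (\<chi> i. if e i < e k then (x i)\<^sup>2 - c i * x i else 0)"
  have "v + a *s d \<in> layer e k c" for a
  proof -
    have "(v + a *s d) $ i = (x i)\<^sup>2 + ((v + a *s d) $ k - c i) * x i" if "e i < e k" for i
      using that dk by (simp add: v_def x_def field_simps)
    moreover have "(v + a *s d) $ i = 0" if "e i > e k" for i
      using that d0 by (simp add: v_def)
    ultimately show ?thesis
      by (auto simp: layer_def quad_range_def simp del: vector_add_component)
  qed
  then show ?thesis by blast
qed

lemma subspace_dim_1E:
  fixes L :: "('a::field ^ 'n) set"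
  assumes "vec.dim L = 1"
  obtains d where "d \<noteq> 0" "L \<subseteq> range (\<lambda>a. a *s d)"
proof -
  obtain B where B: "B \<subseteq> L" "vec.independent B" "L \<subseteq> vec.span B" "card B = vec.dim L"
    using vec.basis_exists by blast
  then obtain d where "B = {d}" using assms card_1_singletonE by metis
  with B show thesis
    by (intro that[of d]) (auto simp: vec.span_singleton vec.dependent_single)
qed

lemma rank1_kakeya_set_layers:
  fixes c :: "'n::finite \<Rightarrow> 'n \<Rightarrow> 'a::field"
  assumes "inj e"
  shows "rank1_kakeya_set (\<Union>k. layer e k (c k))"
  unfolding rank1_kakeya_set_def
proof (intro allI impI)
  fix L :: "('a ^ 'n) set"
  assume "vec.subspace L \<and> vec.dim L = 1"
  then obtain d where d: "d \<noteq> 0" "L \<subseteq> range (\<lambda>a. a *s d)"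
    using subspace_dim_1E by blast
  have "{i. d $ i \<noteq> 0} \<noteq> {}" using d(1) by (auto simp: vec_eq_iff)
  \<comment> \<open>The pivot is the nonzero coordinate of \<open>d\<close> with the largest number
    under \<open>e\<close>.\<close>
  then obtain k where k: "d $ k \<noteq> 0" "\<And>i. d $ i \<noteq> 0 \<Longrightarrow> e i \<le> e k"
    using Max_in[of "e ` {i. d $ i \<noteq> 0}"] Max_ge[of "e ` {i. d $ i \<noteq> 0}"] by fastforce
  then have "d $ i = 0" if "e i > e k" for i
    using that by force
  then obtain v where "\<forall>a. v + a *s d \<in> layer e k (c k)"
    using line_subset_layer[OF assms k(1)] by blast
  with d(2) show "\<exists>v. (+) v ` L \<subseteq> (\<Union>k. layer e k (c k))"
    by (intro exI[of _ v]) auto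
qed

lemma ex_small_rank1_kakeya_set:
  "\<exists>K :: ('a::{field,finite} ^ 'n::finite) set. rank1_kakeya_set K \<and>
     real (card K) \<le> (\<Sum>j<CARD('n). real CARD('a) * ((real CARD('a) + 1) / 2) ^ j)"
proof -
  define u :: real where "u = (real CARD('a) + 1) / 2"
  obtain e :: "'n \<Rightarrow> nat" where e: "bij_betw e UNIV {..<CARD('n)}"
    using ex_bij_betw_finite_nat[of "UNIV :: 'n set"] by (auto simp: atLeast0LessThan)
  then have inj: "inj e" by (simp add: bij_betw_def)
  \<comment> \<open>This count is the number of constrained coordinates in layer \<open>k\<close>,
    hence the exponent of \<open>u\<close>; as \<open>e\<close> takes each value below
    \<open>CARD('n)\<close> once, the layer bounds form a geometric sum.\<close>
  have card_below: "card {i. e i < e k} = e k" for k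
  proof -
    have "e k < CARD('n)" using e by (auto simp: bij_betw_def)
    moreover have "e ` {i. e i < e k} = range e \<inter> {..<e k}" by auto
    ultimately have "e ` {i. e i < e k} = {..<e k}"
      using e by (auto simp: bij_betw_def)
    moreover have "card (e ` {i. e i < e k}) = card {i. e i < e k}"
      using inj by (intro card_image) (auto intro: inj_on_subset)
    ultimately show ?thesis by simp
  qed
  have "2 * real (\<Sum>t\<in>UNIV. card (quad_range (t :: 'a))) \<le> CARD('a) * (CARD('a) + 1)"
    using of_nat_mono[OF sum_card_quad_range[where 'a = 'a], where 'a = real] by simp
  then have mean: "(\<Sum>t\<in>UNIV. real (card (quad_range (t :: 'a)))) \<le> CARD('a) * u"
    by (simp add: u_def algebra_simps)
  have "\<exists>c :: 'n \<Rightarrow> 'a. (\<Sum>t\<in>UNIV. \<Prod>i | e i < e k. real (card (quad_range (t - c i)))) \<le>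
      CARD('a) * u ^ e k" for k
    using ex_shifts_sum_prod_le[OF _ _ mean, of "{i. e i < e k}"] by (simp add: card_below)
  then obtain c :: "'n \<Rightarrow> 'n \<Rightarrow> 'a" where c:
    "(\<Sum>t\<in>UNIV. \<Prod>i | e i < e k. real (card (quad_range (t - c k i)))) \<le> CARD('a) * u ^ e k" for k
    by metis
  have "real (card (layer e k (c k))) \<le> CARD('a) * u ^ e k" for k
    using of_nat_mono[OF card_layer_le[OF inj, of k "c k"], where 'a = real] c[of k] by simp
  then have "(\<Sum>k\<in>UNIV. real (card (layer e k (c k)))) \<le> (\<Sum>k\<in>UNIV. CARD('a) * u ^ e k)"
    by (rule sum_mono)
  also have "\<dots> = (\<Sum>j<CARD('n). CARD('a) * u ^ j)"
    by (rule sum.reindex_bij_betw[OF e])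
  finally have "(\<Sum>k\<in>UNIV. real (card (layer e k (c k)))) \<le> (\<Sum>j<CARD('n). CARD('a) * u ^ j)" .
  moreover have "real (card (\<Union>k. layer e k (c k))) \<le> (\<Sum>k\<in>UNIV. real (card (layer e k (c k))))"
    using card_UN_le[of UNIV "\<lambda>k. layer e k (c k)"] by (simp flip: of_nat_sum)
  ultimately show ?thesis
    using rank1_kakeya_set_layers[OF inj, of c] unfolding u_def by force
qed

text \<open>Replacing \<open>u\<close> by \<open>w\<close> and \<open>q\<close> by
  \<open>r * (w - 1)\<close> makes the sum telescope to \<open>r * (w ^ n - 1)\<close>; the lost
  \<open>r > 0\<close> gives strictness.\<close>

lemma geometric_sum_less:
  fixes q u w r :: real
  assumes "0 \<le> u" "u \<le> w" "1 < w" "0 < q" "q \<le> r * (w - 1)"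
  shows "(\<Sum>j<n. q * u ^ j) < r * w ^ n"
proof -
  have r: "r > 0"
  proof (rule ccontr)
    assume "\<not> r > 0"
    then have "r * (w - 1) \<le> 0" using assms by (intro mult_nonpos_nonneg) auto
    then show False using assms by linarith
  qed
  have "(\<Sum>j<n. q * u ^ j) \<le> (\<Sum>j<n. (r * (w - 1)) * w ^ j)"
    using assms by (intro sum_mono mult_mono power_mono) auto
  also have "\<dots> = r * (w ^ n - 1)"
    by (simp add: power_diff_1_eq sum_distrib_left mult.assoc)
  finally show ?thesis using r by (simp add: algebra_simps)
qed

theorem theorem3:
  fixes n q :: nat
  assumes "n \<ge> 1" and "CARD('n::finite) = n"
    and "primepow q" and "CARD('a::{field,finite}) = q"
  shows "\<exists>K :: ('a ^ 'n) set. rank1_kakeya_set K \<and>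
    (odd q \<longrightarrow>
       real (card K) < 2 * (1 + 1 / (real q - 1)) * ((real q + 1) / 2) ^ n) \<and>
    ((\<exists>k. even k \<and> q = 2 ^ k) \<longrightarrow>
       real (card K) < 3 / 2 * (1 + 1 / (real q - 1)) * ((2 * real q + 1) / 3) ^ n) \<and>
    ((\<exists>k. odd k \<and> q = 2 ^ k) \<longrightarrow>
       real (card K) < 3 / 2 * (2 * (real q + sqrt (real q) + 1) / 3) ^ n)"
proof -
  have q: "real q \<ge> 2" using primepow_gt_Suc_0[OF assms(3)] by simp
  then have sqrt_q: "sqrt (real q) \<ge> 1" by simp
  obtain K :: "('a ^ 'n) set" where K: "rank1_kakeya_set K"
    "real (card K) \<le> (\<Sum>j<n. real q * ((real q + 1) / 2) ^ j)"
    using ex_small_rank1_kakeya_set[where 'a = 'a and 'n = 'n] unfolding assms(2,4) by blast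
  \<comment> \<open>In this bound and the next, \<open>r * (w - 1)\<close> equals \<open>q\<close>
    exactly: \<open>w - 1\<close> is \<open>(q - 1) / 2\<close>, respectively
    \<open>2 * (q - 1) / 3\<close>.\<close>
  have "(\<Sum>j<n. real q * ((real q + 1) / 2) ^ j)
      < 2 * (1 + 1 / (real q - 1)) * ((real q + 1) / 2) ^ n"
    using q by (intro geometric_sum_less) (auto simp: field_simps)
  moreover have "(\<Sum>j<n. real q * ((real q + 1) / 2) ^ j)
      < 3 / 2 * (1 + 1 / (real q - 1)) * ((2 * real q + 1) / 3) ^ n"
    using q by (intro geometric_sum_less) (auto simp: field_simps)
  \<comment> \<open>Here \<open>r * (w - 1)\<close> is \<open>q + sqrt q - 1 / 2\<close>, which
    exceeds \<open>q\<close> because \<open>sqrt q \<ge> 1\<close>.\<close>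
  moreover have "(\<Sum>j<n. real q * ((real q + 1) / 2) ^ j)
      < 3 / 2 * (2 * (real q + sqrt (real q) + 1) / 3) ^ n"
    using q sqrt_q by (intro geometric_sum_less) argo+
  ultimately show ?thesis using K by (intro exI[of _ K]) auto
qed

end
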